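(* Let $\theta\in(0,\infty)$ and $k\ge1$. If $w\in\mathcal{C}_{2k}$, then $p_\theta(w)$ is given by $$p_\theta(w)=\sum_{j=0}^{k-1}A_j^{w}\,\lfloor\theta\rfloor^j(\lfloor\theta\rfloor+1)^{k-1-j},$$ where the $A_j^{w}$ are some non-negative constants (depending on $\theta$) such that $\sum_{j=0}^{k-1}A_j^{w}=1$.
   Context: For $n$ large enough that $\lfloor n/\theta\rfloor\ge1$, let $L_\theta(i,j)=(i+j)\bmod\lfloor n/\theta\rfloor$ for $1\le i,j\le n$. A word of length $2k$ is a sequence of $2k$ letters whose first occurrences are in alphabetical order; $w[i]$ is its $i$-th letter; it is pair-matched if every letter appears exactly twice. A pair-matched word is Catalan if sequentially deleting all double letters (two adjacent equal letters) reduces the word to the empty word (e.g. $aabb$, $abbcca$); $\mathcal{C}_{2k}$ is the set of Catalan words of length $2k$. A circuit of length $2k$ is a function $\pi:\{0,\dots,2k\}\to\{1,\dots,n\}$ with $\pi(0)=\pi(2k)$. For a pair-matched word $w$ of length $2k$, $\Pi_\theta^*(w)$ is the set of such circuits for which $w[i]=w[j]$ implies $L_\theta(\pi(i-1),\pi(i))=L_\theta(\pi(j-1),\pi(j))$, and $p_\theta(w)=\lim_{n\to\infty}n^{-(k+1)}\#\Pi_\theta^*(w)$ (this limit exists). The convention $0^0=1$ is used when $\lfloor\theta\rfloor=0$. *)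

theory Defs
  imports Complex_Main "HOL-Library.FuncSet"
begin

text \<open>The alphabet a, b, c, and so on is encoded as 0, 1, 2, and so on; a word is a list over it.
  The informal \<open>w[i]\<close> is 1-based, hence \<open>w ! (i - 1)\<close>.\<close>

text \<open>First occurrences are in alphabetical order: each letter has either been used before,
  or it is the next unused letter of the alphabet.\<close>

definition is_word :: "nat list \<Rightarrow> bool" where
  "is_word w \<longleftrightarrow>
     (\<forall>i<length w. w ! i \<in> set (take i w) \<or> w ! i = card (set (take i w)))"

definition pair_matched :: "nat list \<Rightarrow> bool" where
  "pair_matched w \<longleftrightarrow> (\<forall>a\<in>set w. count_list w a = 2)"

inductive delete_double :: "nat list \<Rightarrow> nat list \<Rightarrow> bool" where
  "delete_double (xs @ [a, a] @ ys) (xs @ ys)"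

text \<open>\<open>catalan_words m\<close> is the set of Catalan words of length \<open>m\<close>; the intermediate words of a
  deletion sequence need not satisfy \<open>is_word\<close>.\<close>

definition catalan_words :: "nat \<Rightarrow> nat list set" where
  "catalan_words m =
     {w. length w = m \<and> is_word w \<and> pair_matched w \<and> delete_double\<^sup>*\<^sup>* w []}"

text \<open>The link function is meant for \<open>\<lfloor>n / \<theta>\<rfloor> \<ge> 1\<close>. For smaller \<open>n\<close> the modulus is 0 and
  \<open>x mod 0 = x\<close>; this concerns finitely many \<open>n\<close> only, so it does not affect the limit below.\<close>

definition link :: "real \<Rightarrow> nat \<Rightarrow> nat \<Rightarrow> nat \<Rightarrow> nat" where
  "link \<theta> n i j = (i + j) mod nat \<lfloor>real n / \<theta>\<rfloor>"

definition circuits :: "nat \<Rightarrow> nat \<Rightarrow> (nat \<Rightarrow> nat) set" where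
  "circuits n m = {\<pi> \<in> {0..m} \<rightarrow>\<^sub>E {1..n}. \<pi> 0 = \<pi> m}"

definition Pi_star :: "real \<Rightarrow> nat \<Rightarrow> nat list \<Rightarrow> (nat \<Rightarrow> nat) set" where
  "Pi_star \<theta> n w =
     {\<pi> \<in> circuits n (length w).
        \<forall>i\<in>{1..length w}. \<forall>j\<in>{1..length w}. w ! (i - 1) = w ! (j - 1) \<longrightarrow>
          link \<theta> n (\<pi> (i - 1)) (\<pi> i) = link \<theta> n (\<pi> (j - 1)) (\<pi> j)}"

text \<open>For a word of length \<open>2 * k\<close> the normalisation is \<open>n ^ (k + 1)\<close>.\<close>

definition normalized_count :: "real \<Rightarrow> nat list \<Rightarrow> nat \<Rightarrow> real" where
  "normalized_count \<theta> w n = real (card (Pi_star \<theta> n w)) / real n ^ (length w div 2 + 1)"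

definition p_theta :: "real \<Rightarrow> nat list \<Rightarrow> real" where
  "p_theta \<theta> w = lim (normalized_count \<theta> w)"

end

theory Submission imports Defs begin

text \<open>Only residues modulo \<open>m = \<lfloor>n / \<theta>\<rfloor>\<close> matter. For a double letter the link condition says
  that the vertices on both sides of the pair are congruent, while the vertex between them is free.
  Hence deleting double letters splits the count into a product of \<open>k + 1\<close> power sums
  \<open>S(s) = (\<Sum>r<m. c r ^ s)\<close>, where \<open>c r\<close> is the number of \<open>x \<le> n\<close> with residue \<open>r\<close> and the
  exponents \<open>s \<ge> 1\<close> add up to \<open>2 * k\<close>. With \<open>F = \<lfloor>\<theta>\<rfloor>\<close>, the counts \<open>c r\<close> are eventually \<open>F\<close> or \<open>F + 1\<close>,
  and \<open>S(s) / n\<close> tends to \<open>a * (F + 1) ^ (s - 1) + b * F ^ (s - 1)\<close> with \<open>a, b \<ge> 0\<close>, \<open>a + b = 1\<close>.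
  Expanding the product gives a convex combination of monomials of degree \<open>2 * k - (k + 1)\<close>.\<close>

section \<open>Closed walks of residues and the local effect of a double letter\<close>

fun edge_sums :: "nat \<Rightarrow> nat list \<Rightarrow> nat list" where
  "edge_sums m (x # y # p) = (x + y) mod m # edge_sums m (y # p)"
| "edge_sums m _ = []"

lemma length_edge_sums [simp]: "length (edge_sums m p) = length p - 1"
  by (induction m p rule: edge_sums.induct) auto

lemma nth_edge_sums: "Suc i < length p \<Longrightarrow> edge_sums m p ! i = (p ! i + p ! Suc i) mod m"
  by (induction m p arbitrary: i rule: edge_sums.induct) (auto simp: nth_Cons split: nat.splits)

lemma edge_sums_append: "edge_sums m (q @ x # r) = edge_sums m (q @ [x]) @ edge_sums m (x # r)"
proof (induction q)
  case (Cons a q)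
  then show ?case by (cases q) auto
qed simp

text \<open>Vertices are residues and edges are labelled by letters. Stating the link condition as
  single-valuedness of the letter-to-edge-sum relation makes it a property of a set, which splits
  along concatenations of words.\<close>

definition closed_walks :: "nat \<Rightarrow> nat list \<Rightarrow> nat list set" where
  "closed_walks m w = {p. length p = Suc (length w) \<and> set p \<subseteq> {..<m} \<and> hd p = last p \<and>
     single_valued (set (zip w (edge_sums m p)))}"

lemma finite_closed_walks: "finite (closed_walks m w)"
  by (rule finite_subset[OF _ finite_lists_length_eq[of "{..<m}" "Suc (length w)"]])
    (auto simp: closed_walks_def)

text \<open>As \<open>a\<close> is no first component in \<open>R\<close> or \<open>S\<close>, the
  two displayed pairs can conflict only with each other.\<close>

lemma single_valued_double:
  assumes "a \<notin> fst ` R" "a \<notin> fst ` S"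
  shows "single_valued (R \<union> {(a, s), (a, t)} \<union> S) \<longleftrightarrow> s = t \<and> single_valued (R \<union> S)"
  using assms unfolding single_valued_def by (auto simp: image_iff; fastforce)

text \<open>Equal edge sums at the double letter mean \<open>x + y\<close> and \<open>y + z\<close>
  are congruent modulo \<open>m\<close>; cancelling \<open>y\<close> gives \<open>x = z\<close>,
  both being below \<open>m\<close>. No other edge meets \<open>y\<close>, so it stays free, and
  identifying \<open>x\<close> with \<open>z\<close> leaves a walk for the shortened word.\<close>

lemma closed_walks_double:
  assumes a: "a \<notin> set xs" "a \<notin> set ys"
    and len: "length q = length xs" "length r = length ys"
  shows "q @ x # y # z # r \<in> closed_walks m (xs @ [a, a] @ ys) \<longleftrightarrow>
    x = z \<and> y < m \<and> q @ x # r \<in> closed_walks m (xs @ ys)"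
proof -
  let ?R = "set (zip xs (edge_sums m (q @ [x])))"
  let ?S = "\<lambda>z. set (zip ys (edge_sums m (z # r)))"
  let ?D = "{(a, (x + y) mod m), (a, (y + z) mod m)}"
  have long: "set (zip (xs @ [a, a] @ ys) (edge_sums m (q @ x # y # z # r))) = ?R \<union> ?D \<union> ?S z"
    using len by (subst edge_sums_append) auto
  have short: "set (zip (xs @ ys) (edge_sums m (q @ x # r))) = ?R \<union> ?S x"
    using len by (subst edge_sums_append) auto
  have "a \<notin> fst ` ?R" "a \<notin> fst ` ?S z"
    using a by (auto dest: set_zip_leftD)
  note single = single_valued_double[OF this, of "(x + y) mod m" "(y + z) mod m"]
  have cancel: "x = z" if "(x + y) mod m = (y + z) mod m" "x < m" "z < m"
  proof -
    \<comment> \<open>Cancellation of \<open>y\<close> is done over the integers, where subtraction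
      is not truncated.\<close>
    have "(int x + int y) mod int m = (int y + int z) mod int m"
      using that(1) by (metis of_nat_add of_nat_mod)
    then have "(int x + int y - int y) mod int m = (int y + int z - int y) mod int m"
      by (rule mod_diff_cong) simp
    then show ?thesis using that by simp
  qed
  \<comment> \<open>If \<open>q\<close> or \<open>r\<close> is empty, the double letter sits at an
    end of the word; these forms of the first and last vertex cover that case as well, given
    \<open>x = z\<close>.\<close>
  have ends: "hd (q @ x # y # z # r) = hd (q @ [x])" "last (q @ x # y # z # r) = last (z # r)"
    "hd (q @ x # r) = hd (q @ [x])" "last (q @ x # r) = last (x # r)"
    by (auto simp: hd_append)
  show ?thesis
    unfolding closed_walks_def mem_Collect_eq long short single ends
    using len cancel by (auto simp: add.commute)
qed

section \<open>Weighted sums over closed walks and their factorisation\<close>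

text \<open>In the application \<open>c x\<close> counts the labels with residue \<open>x\<close>,
  and the exponent at a vertex counts the circuit positions merged into it.\<close>

definition weight :: "(nat \<Rightarrow> nat) \<Rightarrow> nat list \<Rightarrow> nat list \<Rightarrow> nat" where
  "weight c e p = prod_list (map2 (\<lambda>x k. c x ^ k) p e)"

definition power_sum :: "nat \<Rightarrow> (nat \<Rightarrow> nat) \<Rightarrow> nat \<Rightarrow> nat" where
  "power_sum m c s = (\<Sum>r<m. c r ^ s)"

lemma weight_double:
  assumes "length q = length d"
  shows "weight c (d @ u # v # t # d') (q @ x # y # x # r) =
    c y ^ v * weight c (d @ (u + t) # d') (q @ x # r)"
  using assms by (simp add: weight_def power_add mult_ac)

text \<open>Walks for the longer word correspond bijectively to pairs of a free middle vertex and a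
  walk for the shorter word. The two neighbours of the middle vertex coincide, so their exponents
  add.\<close>

lemma sum_weight_double:
  assumes a: "a \<notin> set xs" "a \<notin> set ys"
    and len: "length d = length xs" "length d' = length ys"
  shows "(\<Sum>p\<in>closed_walks m (xs @ [a, a] @ ys). weight c (d @ u # v # t # d') p) =
    power_sum m c v * (\<Sum>p\<in>closed_walks m (xs @ ys). weight c (d @ (u + t) # d') p)"
proof -
  let ?l = "length xs"
  \<comment> \<open>\<open>drop ?l p\<close> begins with \<open>p ! ?l\<close> again, so
    \<open>ins\<close> puts a copy of that vertex on each side of \<open>y\<close>. Its inverse
    \<open>del\<close> keeps only the second copy.\<close>
  define ins where "ins = (\<lambda>(y :: nat, p). take ?l p @ p ! ?l # y # drop ?l p)"
  define del where "del = (\<lambda>p :: nat list. (p ! Suc ?l, take ?l p @ drop (Suc (Suc ?l)) p))"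
  have ins: "ins (y, q @ x # r) = q @ x # y # x # r" if "length q = ?l" for y q x r
    unfolding ins_def using that by (simp flip: that)
  have del: "del (q @ x # y # x # r) = (y, q @ x # r)" if "length q = ?l" for y q x r
    unfolding del_def using that by (simp add: nth_append flip: that)
  have short: "\<exists>q x r. p = q @ x # r \<and> length q = ?l \<and> length r = length ys"
    if "p \<in> closed_walks m (xs @ ys)" for p
  proof (intro exI conjI)
    show "p = take ?l p @ p ! ?l # drop (Suc ?l) p"
      using that by (intro id_take_nth_drop) (auto simp: closed_walks_def)
  qed (use that in \<open>auto simp: closed_walks_def\<close>)
  have long: "\<exists>q x y r. p = q @ x # y # x # r \<and> length q = ?l \<and> length r = length ys \<and>
      y < m \<and> q @ x # r \<in> closed_walks m (xs @ ys)"
    if p: "p \<in> closed_walks m (xs @ [a, a] @ ys)" for p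
  proof -
    have *: "length p = ?l + length ys + 3" using p by (auto simp: closed_walks_def)
    define q where "q = take ?l p"
    have q: "length q = ?l" using * by (simp add: q_def)
    have "length (drop ?l p) = Suc (Suc (Suc (length ys)))" using * by simp
    then obtain x y z r where r: "drop ?l p = x # y # z # r" "length r = length ys"
      by (auto simp: length_Suc_conv simp del: length_drop)
    have eq: "p = q @ x # y # z # r" using r(1) by (metis append_take_drop_id q_def)
    have "x = z \<and> y < m \<and> q @ x # r \<in> closed_walks m (xs @ ys)"
      using p unfolding eq closed_walks_double[OF a q r(2)] .
    with eq q r(2) show ?thesis by blast
  qed
  have "(\<Sum>p\<in>closed_walks m (xs @ [a, a] @ ys). weight c (d @ u # v # t # d') p) =
    (\<Sum>(y, p)\<in>{..<m} \<times> closed_walks m (xs @ ys). c y ^ v * weight c (d @ (u + t) # d') p)"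
  proof (rule sum.reindex_bij_witness[where i = ins and j = del])
    fix p assume "p \<in> closed_walks m (xs @ [a, a] @ ys)"
    then obtain q x y r where p: "p = q @ x # y # x # r"
      and q: "length q = ?l" and y: "y < m" "q @ x # r \<in> closed_walks m (xs @ ys)"
      using long by blast
    from q len have "length q = length d" by simp
    from weight_double[OF this]
    show "(case del p of (y, p) \<Rightarrow> c y ^ v * weight c (d @ (u + t) # d') p) =
        weight c (d @ u # v # t # d') p"
      unfolding p del[OF q] prod.case by (rule sym)
    show "ins (del p) = p" "del p \<in> {..<m} \<times> closed_walks m (xs @ ys)"
      using y unfolding p del[OF q] ins[OF q] by simp_all
  next
    fix b assume "b \<in> {..<m} \<times> closed_walks m (xs @ ys)"
    then obtain y q x r where b: "b = (y, q @ x # r)" and q: "length q = ?l"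
      and r: "length r = length ys" and y: "y < m" "q @ x # r \<in> closed_walks m (xs @ ys)"
      using short by (cases b) blast
    show "del (ins b) = b" "ins b \<in> closed_walks m (xs @ [a, a] @ ys)"
      using y closed_walks_double[OF a q r] unfolding b ins[OF q] del[OF q] by simp_all
  qed
  then show ?thesis
    by (simp add: power_sum_def sum_product sum.cartesian_product)
qed

lemma pair_matched_double:
  assumes "pair_matched (xs @ [a, a] @ ys)"
  shows "a \<notin> set xs" "a \<notin> set ys" "pair_matched (xs @ ys)"
proof -
  have "count_list (xs @ [a, a] @ ys) a = 2" using assms by (auto simp: pair_matched_def)
  then show a: "a \<notin> set xs" "a \<notin> set ys" by (auto simp: count_list_0_iff)
  show "pair_matched (xs @ ys)" unfolding pair_matched_def
  proof
    fix b assume b: "b \<in> set (xs @ ys)"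
    with a have "b \<noteq> a" by auto
    moreover have "count_list (xs @ [a, a] @ ys) b = 2" using assms b by (auto simp: pair_matched_def)
    ultimately show "count_list (xs @ ys) b = 2" by simp
  qed
qed

text \<open>Deleting a double letter merges two vertices, whose exponents add up, and splits off the
  vertex between them as a free factor. The last exponent may be 0, because the last vertex of a
  closed walk repeats the first one.\<close>

lemma sum_weight_eq_prod_power_sum:
  assumes "delete_double\<^sup>*\<^sup>* w []" "pair_matched w" "length e = Suc (length w)"
    "\<forall>x\<in>set (butlast e). 1 \<le> x" "1 \<le> hd e"
  shows "\<exists>ss. length ss = length w div 2 + 1 \<and> sum_list ss = sum_list e \<and> (\<forall>s\<in>set ss. 1 \<le> s) \<and>
    (\<forall>m c. (\<Sum>p\<in>closed_walks m w. weight c e p) = (\<Prod>s\<leftarrow>ss. power_sum m c s))"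
  using assms
proof (induction w arbitrary: e rule: converse_rtranclp_induct)
  case base
  \<comment> \<open>For the empty word \<open>butlast e\<close> is empty, so
    \<open>1 \<le> s\<close> comes from the hypothesis on \<open>hd e\<close>.\<close>
  then obtain s where e: "e = [s]" by (auto simp: length_Suc_conv)
  have *: "closed_walks m [] = (\<lambda>x. [x]) ` {..<m}" for m
    by (auto simp: closed_walks_def length_Suc_conv single_valued_def)
  show ?case
    by (rule exI[of _ "[s]"])
      (use base e in \<open>auto simp: * sum.reindex weight_def power_sum_def inj_on_def\<close>)
next
  case (step w w')
  from step.hyps(1) obtain xs a ys where w: "w = xs @ [a, a] @ ys" "w' = xs @ ys"
    by (auto elim: delete_double.cases)
  note pm = pair_matched_double[OF step.prems(1)[unfolded w]]
  define d where "d = take (length xs) e"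
  have d: "length d = length xs" using step.prems(2) by (simp add: d_def w)
  have "length (drop (length xs) e) = Suc (Suc (Suc (length ys)))"
    using step.prems(2) by (simp add: w)
  then obtain u v t d' where d': "drop (length xs) e = u # v # t # d'" "length d' = length ys"
    by (auto simp: length_Suc_conv simp del: length_drop)
  have e: "e = d @ u # v # t # d'" using d'(1) by (metis append_take_drop_id d_def)
  let ?e = "d @ (u + t) # d'"
  \<comment> \<open>\<open>u\<close> and \<open>v\<close> are never the last entry of
    \<open>e\<close>, hence positive. So \<open>u + t\<close> is positive even if \<open>t\<close>
    is the final exponent 0.\<close>
  have "\<forall>x\<in>set (butlast ?e). 1 \<le> x" "1 \<le> hd ?e" "1 \<le> v"
    using step.prems(3,4) unfolding e by (auto simp: butlast_append hd_append split: if_splits)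
  then obtain ss where ss: "length ss = length w' div 2 + 1" "sum_list ss = sum_list ?e"
    "\<forall>s\<in>set ss. 1 \<le> s"
    "\<And>m c. (\<Sum>p\<in>closed_walks m w'. weight c ?e p) = (\<Prod>s\<leftarrow>ss. power_sum m c s)"
    using step.IH[of ?e] pm(3) w d d'(2) by auto
  show ?case
    by (rule exI[of _ "v # ss"])
      (use ss \<open>1 \<le> v\<close> sum_weight_double[OF pm(1,2) d d'(2)] in \<open>auto simp: w e\<close>)
qed

section \<open>Counting circuits through their walks of residues\<close>

definition residue_count :: "nat \<Rightarrow> nat \<Rightarrow> nat \<Rightarrow> nat" where
  "residue_count n m r = card {x \<in> {1..n}. x mod m = r}"

text \<open>The final exponent 0 gives the closing vertex weight 1: the label there repeats the
  first and offers no new choice.\<close>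

lemma weight_circuit_exponents:
  assumes "length p = Suc l"
  shows "weight c (replicate l 1 @ [0]) p = (\<Prod>i<l. c (p ! i))"
  using assms
proof (induction l arbitrary: p)
  case 0
  then show ?case by (auto simp: weight_def length_Suc_conv)
next
  case (Suc l)
  then obtain x p' where "p = x # p'" "length p' = Suc l" by (auto simp: length_Suc_conv)
  then show ?case using Suc.IH[of p']
    by (simp add: weight_def prod.lessThan_Suc_shift del: prod.lessThan_Suc)
qed

definition residues :: "nat \<Rightarrow> nat \<Rightarrow> (nat \<Rightarrow> nat) \<Rightarrow> nat list" where
  "residues m l f = map (\<lambda>i. f i mod m) [0..<Suc l]"

text \<open>The link value of two labels depends only on their residues, so the matching condition
  can be read off the reduced circuit.\<close>

lemma Pi_star_conv_residues:
  assumes m: "nat \<lfloor>real n / \<theta>\<rfloor> = m" "0 < m"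
  shows "Pi_star \<theta> n w =
    {f \<in> circuits n (length w). residues m (length w) f \<in> closed_walks m w}"
proof -
  have "(\<forall>i\<in>{1..length w}. \<forall>j\<in>{1..length w}. w ! (i - 1) = w ! (j - 1) \<longrightarrow>
          link \<theta> n (f (i - 1)) (f i) = link \<theta> n (f (j - 1)) (f j)) \<longleftrightarrow>
        residues m (length w) f \<in> closed_walks m w" (is "?L \<longleftrightarrow> ?R")
    if f: "f \<in> circuits n (length w)" for f
  proof -
    let ?p = "residues m (length w) f"
    \<comment> \<open>Writing the one-based positions as successors turns them into list
      indices.\<close>
    have "?L \<longleftrightarrow> (\<forall>i\<in>Suc ` {..<length w}. \<forall>j\<in>Suc ` {..<length w}. w ! (i - 1) = w ! (j - 1) \<longrightarrow>
          link \<theta> n (f (i - 1)) (f i) = link \<theta> n (f (j - 1)) (f j))"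
      by (simp add: image_Suc_lessThan)
    also have "\<dots> \<longleftrightarrow> (\<forall>i<length w. \<forall>j<length w. w ! i = w ! j \<longrightarrow>
        (f i + f (Suc i)) mod m = (f j + f (Suc j)) mod m)"
      unfolding link_def m(1) by auto
    also have "\<dots> \<longleftrightarrow> (\<forall>i<length w. \<forall>j<length w. w ! i = w ! j \<longrightarrow>
        edge_sums m ?p ! i = edge_sums m ?p ! j)"
      by (simp add: nth_edge_sums residues_def mod_add_eq del: upt_Suc)
    also have "\<dots> \<longleftrightarrow> single_valued (set (zip w (edge_sums m ?p)))"
      unfolding single_valued_def set_zip by (auto simp: residues_def; metis)
    \<comment> \<open>The other conditions on a closed walk are automatic: residues lie below the
      positive \<open>m\<close>, and the ends agree because \<open>f\<close> is a circuit.\<close>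
    also have "\<dots> \<longleftrightarrow> ?R"
    proof -
      have "hd ?p = f 0 mod m" "last ?p = f (length w) mod m"
        by (simp_all add: residues_def hd_map last_map del: upt_Suc)
      with f m(2) show ?thesis
        by (auto simp: closed_walks_def circuits_def residues_def)
    qed
    finally show ?thesis .
  qed
  then show ?thesis by (auto simp: Pi_star_def)
qed

text \<open>The first \<open>l\<close> labels are chosen independently, each in its residue class,
  and the last label is then forced.\<close>

lemma card_circuits_residues:
  assumes p: "length p = Suc l" "hd p = last p" and l: "0 < l"
  shows "card {f \<in> circuits n l. residues m l f = p} = (\<Prod>i<l. residue_count n m (p ! i))"
proof -
  let ?B = "\<Pi>\<^sub>E i\<in>{..<l}. {x \<in> {1..n}. x mod m = p ! i}"
  have residues_iff: "residues m l f = p \<longleftrightarrow> (\<forall>i\<le>l. f i mod m = p ! i)" for f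
    using p(1) by (auto simp: residues_def list_eq_iff_nth_eq less_Suc_eq_le simp del: upt_Suc)
  have ends: "p ! l = p ! 0"
    using p by (metis Suc_neq_Zero diff_Suc_1 hd_conv_nth last_conv_nth length_0_conv)
  have "bij_betw (\<lambda>f. restrict f {..<l}) {f \<in> circuits n l. residues m l f = p} ?B"
  \<comment> \<open>The inverse closes the circuit by copying the value at 0, which lies in the
    domain \<open>{..<l}\<close> since \<open>0 < l\<close>.\<close>
  proof (rule bij_betw_byWitness[where f' = "\<lambda>g. g(l := g 0)"])
    show "\<forall>f\<in>{f \<in> circuits n l. residues m l f = p}.
        (restrict f {..<l})(l := restrict f {..<l} 0) = f"
      using l by (auto simp: circuits_def fun_eq_iff PiE_def extensional_def)
    show "\<forall>g\<in>?B. restrict (g(l := g 0)) {..<l} = g"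
      by (auto simp: fun_eq_iff PiE_def extensional_def)
    show "(\<lambda>f. restrict f {..<l}) ` {f \<in> circuits n l. residues m l f = p} \<subseteq> ?B"
      by (auto simp: residues_iff circuits_def PiE_def Pi_def)
    show "(\<lambda>g. g(l := g 0)) ` ?B \<subseteq> {f \<in> circuits n l. residues m l f = p}"
      using l ends by (auto simp: residues_iff circuits_def PiE_def Pi_def extensional_def)
  qed
  then have "card {f \<in> circuits n l. residues m l f = p} = card ?B" by (rule bij_betw_same_card)
  also have "\<dots> = (\<Prod>i<l. residue_count n m (p ! i))"
    by (simp add: card_PiE residue_count_def)
  finally show ?thesis .
qed

text \<open>The circuits are partitioned according to their walks of residues.\<close>

lemma card_Pi_star:
  assumes m: "nat \<lfloor>real n / \<theta>\<rfloor> = m" "0 < m" and w: "w \<noteq> []"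
  shows "card (Pi_star \<theta> n w) =
    (\<Sum>p\<in>closed_walks m w. weight (residue_count n m) (replicate (length w) 1 @ [0]) p)"
proof -
  let ?l = "length w"
  have "Pi_star \<theta> n w = (\<Union>p\<in>closed_walks m w. {f \<in> circuits n ?l. residues m ?l f = p})"
    by (auto simp: Pi_star_conv_residues[OF m])
  also have "card \<dots> = (\<Sum>p\<in>closed_walks m w. card {f \<in> circuits n ?l. residues m ?l f = p})"
  proof (rule card_UN_disjoint)
    have "finite (circuits n ?l)"
      by (rule finite_subset[OF _ finite_PiE[of "{0..?l}" "\<lambda>_. {1..n}"]]) (auto simp: circuits_def)
    then show "\<forall>p\<in>closed_walks m w. finite {f \<in> circuits n ?l. residues m ?l f = p}" by simp
  qed (auto simp: finite_closed_walks)
  also have "\<dots> = (\<Sum>p\<in>closed_walks m w. weight (residue_count n m) (replicate ?l 1 @ [0]) p)"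
    using w by (intro sum.cong)
      (auto simp: closed_walks_def card_circuits_residues weight_circuit_exponents[simplified])
  finally show ?thesis .
qed

section \<open>Asymptotics of the power sums\<close>

text \<open>Each full block of \<open>m\<close> consecutive labels meets every residue once. Labels
  start at 1, so the \<open>n mod m\<close> surplus labels have residues
  \<open>1, ..., n mod m\<close>, and residue 0 gets no surplus.\<close>

lemma residue_count_eq:
  assumes "0 < m" "r < m"
  shows "residue_count n m r = n div m + (if 1 \<le> r \<and> r \<le> n mod m then 1 else 0)"
proof (induction n)
  case 0
  then show ?case by (simp add: residue_count_def)
next
  case (Suc n)
  have "{x \<in> {1..Suc n}. x mod m = r} =
      (if Suc n mod m = r then insert (Suc n) {x \<in> {1..n}. x mod m = r}
       else {x \<in> {1..n}. x mod m = r})"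
    by (auto simp: le_Suc_eq)
  then have "residue_count (Suc n) m r =
      residue_count n m r + (if Suc n mod m = r then 1 else 0)"
    by (simp add: residue_count_def)
  then show ?case
    using Suc assms by (auto simp: div_Suc mod_Suc split: if_splits)
qed

lemma power_sum_residue_count:
  assumes "0 < m"
  shows "power_sum m (residue_count n m) s =
    (n mod m) * (n div m + 1) ^ s + (m - n mod m) * (n div m) ^ s"
proof -
  have lt: "n mod m < m" using assms by simp
  have "power_sum m (residue_count n m) s =
      (\<Sum>r<m. if r \<in> {1..n mod m} then (n div m + 1) ^ s else (n div m) ^ s)"
    unfolding power_sum_def using assms by (intro sum.cong) (auto simp: residue_count_eq)
  also have "\<dots> = card ({..<m} \<inter> {1..n mod m}) * (n div m + 1) ^ s +
      card ({..<m} \<inter> - {1..n mod m}) * (n div m) ^ s"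
    by (simp add: sum.If_cases del: atLeastAtMost_iff)
  also have "{..<m} \<inter> {1..n mod m} = {1..n mod m}" using lt by auto
  also have "{..<m} \<inter> - {1..n mod m} = {..<m} - {1..n mod m}" by auto
  also have "card ({..<m} - {1..n mod m}) = m - n mod m"
    using lt by (subst card_Diff_subset) auto
  finally show ?thesis by simp
qed

text \<open>Eventually \<open>n div m = F\<close>, so \<open>n - F * m\<close> residues occur
  \<open>F + 1\<close> times and \<open>(F + 1) * m - n\<close> occur \<open>F\<close> times.
  Dividing by \<open>n\<close> and using that \<open>m / n\<close> tends to
  \<open>1 / \<theta>\<close> gives the two coefficients.\<close>

lemma tendsto_power_sum:
  fixes \<theta> :: real and s :: nat
  defines "m \<equiv> \<lambda>n. nat \<lfloor>real n / \<theta>\<rfloor>" and "F \<equiv> of_int \<lfloor>\<theta>\<rfloor> :: real"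
  assumes \<theta>: "0 < \<theta>"
  shows "eventually (\<lambda>n. 0 < m n) sequentially"
    and "(\<lambda>n. real (power_sum (m n) (residue_count n (m n)) s) / real n) \<longlonglongrightarrow>
      (1 - F / \<theta>) * (F + 1) ^ s + ((F + 1) / \<theta> - 1) * F ^ s"
proof -
  define f where "f = nat \<lfloor>\<theta>\<rfloor>"
  have F: "F = real f" using \<theta> by (simp add: F_def f_def)
  have f: "real f \<le> \<theta>" "\<theta> < real f + 1" unfolding F[symmetric] F_def by linarith+
  have m_le: "real (m n) \<le> real n / \<theta>" and m_ge: "real n / \<theta> - 1 \<le> real (m n)" for n
    using \<theta> by (simp_all add: m_def)
  have lim: "(\<lambda>n. real (m n) / real n) \<longlonglongrightarrow> 1 / \<theta>"
  proof (rule tendsto_sandwich)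
    have "(\<lambda>n. 1 / \<theta> - 1 / real n) \<longlonglongrightarrow> 1 / \<theta> - 0"
      by (intro tendsto_diff tendsto_const lim_1_over_n)
    then show "(\<lambda>n. 1 / \<theta> - 1 / real n) \<longlonglongrightarrow> 1 / \<theta>" by simp
    show "eventually (\<lambda>n. 1 / \<theta> - 1 / real n \<le> real (m n) / real n) sequentially"
      using eventually_gt_at_top[of 0]
    proof eventually_elim
      case (elim n)
      have "(real n / \<theta> - 1) / real n \<le> real (m n) / real n"
        by (rule divide_right_mono[OF m_ge]) simp
      then show ?case using elim by (simp add: diff_divide_distrib)
    qed
    show "eventually (\<lambda>n. real (m n) / real n \<le> 1 / \<theta>) sequentially"
      using eventually_gt_at_top[of 0]
    proof eventually_elim
      case (elim n)
      have "real (m n) / real n \<le> (real n / \<theta>) / real n"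
        by (rule divide_right_mono[OF m_le]) simp
      then show ?case using elim by simp
    qed
  qed simp
  have "0 < 1 / \<theta>" using \<theta> by simp
  from order_tendstoD(1)[OF lim this]
  show pos: "eventually (\<lambda>n. 0 < m n) sequentially"
    by eventually_elim (auto intro: gr0I)
  \<comment> \<open>The strict bound \<open>\<theta> < F + 1\<close> survives replacing
    \<open>1 / \<theta>\<close> by a nearby \<open>m / n\<close>; this yields
    \<open>n < (F + 1) * m\<close> for large \<open>n\<close>.\<close>
  have "(\<lambda>n. real (m n) / real n * (real f + 1)) \<longlonglongrightarrow> 1 / \<theta> * (real f + 1)"
    by (intro tendsto_intros lim)
  moreover have "1 < 1 / \<theta> * (real f + 1)" using f \<theta> by (simp add: field_simps)
  ultimately have upper: "eventually (\<lambda>n. 1 < real (m n) / real n * (real f + 1)) sequentially"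
    by (rule order_tendstoD(1))
  have "eventually (\<lambda>n. (1 - F * (real (m n) / real n)) * (F + 1) ^ s +
      ((F + 1) * (real (m n) / real n) - 1) * F ^ s =
      real (power_sum (m n) (residue_count n (m n)) s) / real n) sequentially"
    using pos upper eventually_gt_at_top[of 0]
  proof eventually_elim
    case (elim n)
    \<comment> \<open>The lower bound \<open>F * m \<le> n\<close> is exact for every
      \<open>n\<close>, so integral \<open>\<theta>\<close>, where \<open>F = \<theta>\<close>, is
      covered too.\<close>
    have "real f * real (m n) \<le> \<theta> * (real n / \<theta>)"
      using f(1) m_le[of n] \<theta> by (intro mult_mono) auto
    then have "real (f * m n) \<le> real n" using \<theta> by simp
    then have le: "f * m n \<le> n" by (simp only: of_nat_le_iff)
    have "real n < real (m n) * (real f + 1)" using elim by (simp add: field_simps)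
    then have "real n < real (m n * (f + 1))" by (simp add: algebra_simps)
    then have lt: "n < m n * (f + 1)" by (simp only: of_nat_less_iff)
    have div: "n div m n = f"
      using le lt by (intro div_nat_eqI) (simp_all add: algebra_simps)
    then have mod: "n mod m n = n - f * m n"
      by (metis minus_div_mult_eq_mod)
    have "real (m n - (n - f * m n)) = (real f + 1) * real (m n) - real n"
      using le lt by (simp add: of_nat_diff algebra_simps)
    then have "real (power_sum (m n) (residue_count n (m n)) s) =
        (real n - F * real (m n)) * (F + 1) ^ s + ((F + 1) * real (m n) - real n) * F ^ s"
      using le by (simp add: power_sum_residue_count elim(1) div mod F of_nat_diff add.commute)
    moreover have "(real n - F * real (m n)) / real n = 1 - F * (real (m n) / real n)"
      "((F + 1) * real (m n) - real n) / real n = (F + 1) * (real (m n) / real n) - 1"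
      using elim(3) by (simp_all add: diff_divide_distrib)
    ultimately show ?case
      by (metis add_divide_distrib times_divide_eq_left)
  qed
  moreover have "(\<lambda>n. (1 - F * (real (m n) / real n)) * (F + 1) ^ s +
      ((F + 1) * (real (m n) / real n) - 1) * F ^ s) \<longlonglongrightarrow>
      (1 - F * (1 / \<theta>)) * (F + 1) ^ s + ((F + 1) * (1 / \<theta>) - 1) * F ^ s"
    by (intro tendsto_intros lim)
  ultimately show "(\<lambda>n. real (power_sum (m n) (residue_count n (m n)) s) / real n) \<longlonglongrightarrow>
      (1 - F / \<theta>) * (F + 1) ^ s + ((F + 1) / \<theta> - 1) * F ^ s"
    by (auto dest: Lim_transform_eventually)
qed

section \<open>Convex combinations of monomials of fixed degree\<close>

definition monomial_mixture :: "real \<Rightarrow> real \<Rightarrow> nat \<Rightarrow> real \<Rightarrow> bool" where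
  "monomial_mixture x y N v \<longleftrightarrow> (\<exists>A. (\<forall>j\<le>N. 0 \<le> A j) \<and> (\<Sum>j\<le>N. A j) = 1 \<and>
     v = (\<Sum>j\<le>N. A j * y ^ j * x ^ (N - j)))"

lemma monomial_mixture_mult_left:
  assumes "monomial_mixture x y N v"
  shows "monomial_mixture x y (Suc N) (x * v)"
proof -
  obtain A where A: "\<forall>j\<le>N. 0 \<le> A j" "(\<Sum>j\<le>N. A j) = 1"
    "v = (\<Sum>j\<le>N. A j * y ^ j * x ^ (N - j))"
    using assms by (auto simp: monomial_mixture_def)
  show ?thesis unfolding monomial_mixture_def
    \<comment> \<open>A factor \<open>x\<close> leaves the exponents of \<open>y\<close> alone, so
      the coefficients stay and the new top one is 0.\<close>
    by (rule exI[of _ "A(Suc N := 0)"])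
      (use A in \<open>auto simp: sum_distrib_left Suc_diff_le mult_ac intro!: sum.cong\<close>)
qed

lemma monomial_mixture_mult_right:
  assumes "monomial_mixture x y N v"
  shows "monomial_mixture x y (Suc N) (y * v)"
proof -
  obtain A where A: "\<forall>j\<le>N. 0 \<le> A j" "(\<Sum>j\<le>N. A j) = 1"
    "v = (\<Sum>j\<le>N. A j * y ^ j * x ^ (N - j))"
    using assms by (auto simp: monomial_mixture_def)
  show ?thesis unfolding monomial_mixture_def
    \<comment> \<open>A factor \<open>y\<close> raises each exponent of \<open>y\<close> by one, so
      the coefficients shift up and the bottom one is 0.\<close>
    by (rule exI[of _ "case_nat 0 A"])
      (use A in \<open>auto simp: sum.atMost_Suc_shift sum_distrib_left mult_ac
        simp del: sum.atMost_Suc split: nat.splits\<close>)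
qed

lemma monomial_mixture_convex:
  assumes "monomial_mixture x y N u" "monomial_mixture x y N v" "0 \<le> a" "0 \<le> b" "a + b = 1"
  shows "monomial_mixture x y N (a * u + b * v)"
proof -
  obtain A B where A: "\<forall>j\<le>N. 0 \<le> A j" "(\<Sum>j\<le>N. A j) = 1"
      "u = (\<Sum>j\<le>N. A j * y ^ j * x ^ (N - j))"
    and B: "\<forall>j\<le>N. 0 \<le> B j" "(\<Sum>j\<le>N. B j) = 1"
      "v = (\<Sum>j\<le>N. B j * y ^ j * x ^ (N - j))"
    using assms(1,2) by (auto simp: monomial_mixture_def)
  show ?thesis unfolding monomial_mixture_def
  proof (intro exI[of _ "\<lambda>j. a * A j + b * B j"] conjI)
    show "(\<Sum>j\<le>N. a * A j + b * B j) = 1"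
      using A(2) B(2) assms(5) by (simp add: sum.distrib flip: sum_distrib_left)
  qed (use A B assms(3,4) in
      \<open>auto simp: sum.distrib sum_distrib_left distrib_right mult.assoc\<close>)
qed

text \<open>Multiplying a mixture by \<open>x ^ d\<close> or by \<open>y ^ d\<close> raises its
  degree by \<open>d\<close>, and a further factor combines the two results with weights
  \<open>a\<close> and \<open>b\<close>.\<close>

lemma monomial_mixture_prod_list:
  assumes ab: "0 \<le> a" "0 \<le> b" "a + b = 1"
  shows "monomial_mixture x y (sum_list ds) (\<Prod>d\<leftarrow>ds. a * x ^ d + b * y ^ d)"
proof (induction ds)
  case Nil
  then show ?case by (auto simp: monomial_mixture_def intro: exI[of _ "\<lambda>_. 1"])
next
  case (Cons d ds)
  let ?N = "sum_list ds" and ?v = "\<Prod>d\<leftarrow>ds. a * x ^ d + b * y ^ d"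
  have "monomial_mixture x y (d + ?N) (x ^ d * ?v)"
    by (induction d) (auto simp: mult.assoc Cons.IH intro: monomial_mixture_mult_left)
  moreover have "monomial_mixture x y (d + ?N) (y ^ d * ?v)"
    by (induction d) (auto simp: mult.assoc Cons.IH intro: monomial_mixture_mult_right)
  ultimately have "monomial_mixture x y (d + ?N) (a * (x ^ d * ?v) + b * (y ^ d * ?v))"
    using ab by (rule monomial_mixture_convex)
  then show ?case by (simp add: algebra_simps)
qed

section \<open>The limit and its coefficients\<close>

lemma tendsto_prod_list:
  fixes f :: "nat \<Rightarrow> 'a \<Rightarrow> real"
  assumes "\<And>s. s \<in> set ss \<Longrightarrow> (\<lambda>n. f n s) \<longlonglongrightarrow> g s"
  shows "(\<lambda>n. \<Prod>s\<leftarrow>ss. f n s) \<longlonglongrightarrow> (\<Prod>s\<leftarrow>ss. g s)"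
  using assms by (induction ss) (auto intro: tendsto_mult)

theorem theorem4p1:
  fixes \<theta> :: real and k :: nat and w :: "nat list"
  assumes "0 < \<theta>" and "1 \<le> k" and "w \<in> catalan_words (2 * k)"
  shows "convergent (normalized_count \<theta> w) \<and>
    (\<exists>A :: nat \<Rightarrow> real.
       (\<forall>j\<in>{0..k - 1}. 0 \<le> A j) \<and>
       (\<Sum>j = 0..k - 1. A j) = 1 \<and>
       p_theta \<theta> w =
         (\<Sum>j = 0..k - 1. A j * of_int \<lfloor>\<theta>\<rfloor> ^ j * (of_int \<lfloor>\<theta>\<rfloor> + 1) ^ (k - 1 - j)))"
proof -
  define m where "m = (\<lambda>n. nat \<lfloor>real n / \<theta>\<rfloor>)"
  define F where "F = (of_int \<lfloor>\<theta>\<rfloor> :: real)"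
  have w: "length w = 2 * k" "pair_matched w" "delete_double\<^sup>*\<^sup>* w []"
    using assms(3) by (auto simp: catalan_words_def)
  let ?e = "replicate (length w) 1 @ [0 :: nat]"
  have e: "length ?e = Suc (length w)" "\<forall>x\<in>set (butlast ?e). 1 \<le> x" "1 \<le> hd ?e"
    using w(1) assms(2) by (simp_all add: butlast_append hd_append)
  \<comment> \<open>The exponents \<open>ss\<close> are fixed before \<open>m\<close> and
    \<open>c\<close>, so one list serves all \<open>n\<close> and the limit can be taken factor by
    factor.\<close>
  from sum_weight_eq_prod_power_sum[OF w(3,2) e]
  obtain ss where ss: "length ss = k + 1" "sum_list ss = 2 * k" "\<forall>s\<in>set ss. 1 \<le> s"
    and count: "\<And>m c. (\<Sum>p\<in>closed_walks m w. weight c ?e p) = (\<Prod>s\<leftarrow>ss. power_sum m c s)"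
    using w(1) by (auto simp: sum_list_replicate)
  \<comment> \<open>As \<open>ss\<close> has \<open>k + 1\<close> entries, the normalisation
    \<open>n ^ (k + 1)\<close> gives one division by \<open>n\<close> to each power sum.\<close>
  have factor: "real (\<Prod>s\<leftarrow>us. g s) / x ^ length us = (\<Prod>s\<leftarrow>us. real (g s) / x)"
    for g :: "nat \<Rightarrow> nat" and us and x :: real
    by (induction us) (auto simp flip: times_divide_times_eq)
  have "eventually (\<lambda>n. (\<Prod>s\<leftarrow>ss. real (power_sum (m n) (residue_count n (m n)) s) / real n) =
      normalized_count \<theta> w n) sequentially"
    using tendsto_power_sum(1)[OF assms(1)]
  proof eventually_elim
    case (elim n)
    have "w \<noteq> []" using w(1) assms(2) by auto
    then have "card (Pi_star \<theta> n w) = (\<Prod>s\<leftarrow>ss. power_sum (m n) (residue_count n (m n)) s)"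
      unfolding m_def count[symmetric] by (rule card_Pi_star[OF refl elim])
    then show ?case
      using factor[of _ ss] ss(1) w(1) by (simp add: normalized_count_def)
  qed
  \<comment> \<open>Moving one factor \<open>F + 1\<close> or \<open>F\<close> out of each power
    turns limiting numbers of residues per label into limiting proportions of labels in classes of
    the two sizes; hence \<open>a + b = 1\<close>.\<close>
  moreover define a b where "a = (1 - F / \<theta>) * (F + 1)" and "b = ((F + 1) / \<theta> - 1) * F"
  let ?v = "\<Prod>s\<leftarrow>ss. a * (F + 1) ^ (s - 1) + b * F ^ (s - 1)"
  have "(\<lambda>n. \<Prod>s\<leftarrow>ss. real (power_sum (m n) (residue_count n (m n)) s) / real n) \<longlonglongrightarrow> ?v"
  proof (rule tendsto_prod_list)
    fix s assume "s \<in> set ss"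
    with ss(3) obtain d where "s = Suc d" by (metis Suc_le_D One_nat_def)
    then show "(\<lambda>n. real (power_sum (m n) (residue_count n (m n)) s) / real n) \<longlonglongrightarrow>
        a * (F + 1) ^ (s - 1) + b * F ^ (s - 1)"
      using tendsto_power_sum(2)[OF assms(1), of s] by (simp add: a_def b_def F_def m_def mult.assoc)
  qed
  ultimately have lim: "normalized_count \<theta> w \<longlonglongrightarrow> ?v"
    by (auto dest: Lim_transform_eventually)
  have "F \<ge> 0" "F \<le> \<theta>" "\<theta> \<le> F + 1" using assms(1) unfolding F_def by (simp, linarith+)
  moreover from this have "F / \<theta> \<le> 1" "1 \<le> (F + 1) / \<theta>"
    using assms(1) by (simp_all add: field_simps)
  moreover have "a + b = 1" using assms(1) by (simp add: a_def b_def field_simps)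
  ultimately have ab: "0 \<le> a" "0 \<le> b" "a + b = 1"
    by (simp_all add: a_def b_def)
  \<comment> \<open>Since all exponents are at least 1, the truncated subtractions are exact, and
    the total degree is \<open>2 * k - (k + 1) = k - 1\<close>.\<close>
  have "(\<Sum>s\<leftarrow>us. s - 1) + length us = sum_list us" if "\<forall>s\<in>set us. 1 \<le> s" for us :: "nat list"
    using that by (induction us) auto
  from this[OF ss(3)] have deg: "sum_list (map (\<lambda>s. s - 1) ss) = k - 1"
    using ss(1,2) by simp
  have "monomial_mixture (F + 1) F (k - 1) ?v"
    using monomial_mixture_prod_list[OF ab, of "F + 1" F "map (\<lambda>s. s - 1) ss"]
    unfolding deg by (simp add: o_def)
  then have "monomial_mixture (F + 1) F (k - 1) (p_theta \<theta> w)"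
    using limI[OF lim] by (simp add: p_theta_def)
  then show ?thesis
    using lim unfolding monomial_mixture_def F_def atLeast0AtMost
    by (auto simp: convergent_def)
qed

end
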